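(* Let $p\ge 2$ and $n\ge 0$ be integers, and let $w$ be an integer with $0\le w\le n+1$. The number of vertices of $\Gamma_n^{(p)}$ of weight $w$ is $\binom{n-w+1}{w}_{p-1}$.
   Context: For an integer $n\ge 0$, the hypercube $Q_n$ has vertex set $\{0,1\}^n$ (binary strings of length $n$; for $n=0$ only the empty string), two strings being adjacent iff they differ in exactly one coordinate. For $p\ge2$, a $p$-th order Fibonacci string is a binary string that does not contain $1^p$ ($p$ consecutive 1s) as a substring (of consecutive letters). $\Gamma_n^{(p)}$ is the subgraph of $Q_n$ induced by the $p$-th order Fibonacci strings of length $n$. The (Hamming) weight of a binary string is its number of occurrences of $1$. For integers $p\ge2$, $b\ge 0$ and $a$, the $p$-nomial coefficient $\binom{b}{a}_{p-1}$ is the coefficient of $x^a$ in $(1+x+x^2+\dots+x^{p-1})^b$ (so it is $0$ for $a<0$ or $a>b(p-1)$). *)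

theory Defs
  imports "HOL-Library.Sublist" "HOL-Computational_Algebra.Polynomial"
    "Graph_Theory.Digraph_Component"
begin

text \<open>
  Binary strings are lists over \<^typ>\<open>bool\<close>, with \<^term>\<open>True\<close> for the letter 1 and
  \<^term>\<open>False\<close> for the letter 0. Simple undirected graphs are symmetric loop-free digraphs
  without parallel arcs, i.e. instances of the locales \<^locale>\<open>pair_graph\<close> and \<^locale>\<open>graph\<close>.
\<close>

definition hypercube :: "nat \<Rightarrow> bool list pair_pre_digraph" where
  "hypercube n = \<lparr> pverts = {xs. length xs = n},
     parcs = {(xs, ys). length xs = n \<and> length ys = n \<and> card {i. i < n \<and> xs ! i \<noteq> ys ! i} = 1} \<rparr>"

text \<open>\<^const>\<open>sublist\<close> is the relation of being a contiguous factor (not a subsequence).\<close>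

definition fibonacci_string :: "nat \<Rightarrow> bool list \<Rightarrow> bool" where
  "fibonacci_string p xs \<longleftrightarrow> \<not> sublist (replicate p True) xs"

definition fibonacci_graph :: "nat \<Rightarrow> nat \<Rightarrow> (bool list, bool list \<times> bool list) pre_digraph" where
  "fibonacci_graph p n =
     with_proj (hypercube n) \<restriction> {xs \<in> pverts (hypercube n). fibonacci_string p xs}"

definition weight :: "bool list \<Rightarrow> nat" where
  "weight xs = count_list xs True"

text \<open>
  \<^term>\<open>pnomial p b a\<close> is the coefficient of $x^a$ in $(1 + x + \dots + x^{p-1})^b$,
  conventionally written with the subscript $p-1$ rather than $p$.
\<close>

definition pnomial :: "nat \<Rightarrow> nat \<Rightarrow> int \<Rightarrow> nat" where
  "pnomial p b a =
     (if a < 0 then 0 else poly.coeff ((\<Sum>i<p. monom (1 :: nat) i) ^ b) (nat a))"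

lemma hypercube_sels [simp]:
  "pverts (hypercube n) = {xs. length xs = n}"
  "parcs (hypercube n) =
     {(xs, ys). length xs = n \<and> length ys = n \<and> card {i. i < n \<and> xs ! i \<noteq> ys ! i} = 1}"
  by (simp_all only: hypercube_def pair_pre_digraph.select_convs)

lemma pair_graph_hypercube: "pair_graph (hypercube n)"
proof unfold_locales
  have fin: "finite {xs :: bool list. length xs = n}"
    using finite_lists_length_eq[of "UNIV :: bool set" n] by simp
  then show "finite (pverts (hypercube n))"
    by simp
  have "parcs (hypercube n) \<subseteq> {xs. length xs = n} \<times> {xs. length xs = n}"
    by auto
  then show "finite (parcs (hypercube n))"
    by (rule finite_subset) (use fin in blast)
  have "{i. i < n \<and> ys ! i \<noteq> xs ! i} = {i. i < n \<and> xs ! i \<noteq> ys ! i}"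
    for xs ys :: "bool list"
    by (simp only: neq_commute)
  then have "(ys, xs) \<in> parcs (hypercube n)" if "(xs, ys) \<in> parcs (hypercube n)" for xs ys
    using that by (simp only: hypercube_sels mem_Collect_eq prod.case simp_thms)
  then show "symmetric (with_proj (hypercube n))"
    unfolding symmetric_def with_proj_simps by (rule symI)
next
  fix e assume "e \<in> parcs (hypercube n)"
  then obtain xs ys where e: "e = (xs, ys)" "length xs = n" "length ys = n"
      "card {i. i < n \<and> xs ! i \<noteq> ys ! i} = 1"
    unfolding hypercube_sels by blast
  then show "fst e \<in> pverts (hypercube n)" "snd e \<in> pverts (hypercube n)"
    by simp_all
  show "fst e \<noteq> snd e"
    using e by fastforce
qed

lemma induced_subgraph_fibonacci_graph:
  "induced_subgraph (fibonacci_graph p n) (with_proj (hypercube n))"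
proof -
  interpret pair_graph "hypercube n" by (rule pair_graph_hypercube)
  show ?thesis
    unfolding fibonacci_graph_def by (rule induced_induce) blast
qed

end

theory Submission
  imports Defs
begin

text \<open>
  Append a 0 to a Fibonacci string of length \<open>n\<close> and weight \<open>w\<close>. The result has
  \<open>b = n + 1 - w\<close> zeros and ends with one of them, so cutting it after every 0 writes it, in a unique
  way, as a product of \<open>b\<close> blocks \<open>1\<^sup>a0\<close>. No run of ones extends across a 0, hence the string avoids
  \<open>1\<^sup>p\<close> iff all the exponents \<open>a\<close> are less than \<open>p\<close>. The number of strings is therefore the number
  of \<open>b\<close>-tuples of exponents below \<open>p\<close> with sum \<open>w\<close>, which is the coefficient of \<open>x\<^sup>w\<close> in
  \<open>(1 + x + \<dots> + x\<^sup>p\<^sup>-\<^sup>1)\<^sup>b\<close>.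

  The count is made without the tuples: appending a 0 is a bijection onto the strings that end with 0
  (\<open>append_zero_image_fibonacci_strings\<close>), splitting off the first block
  (\<open>terminated_strings_Suc\<close>) gives a recursion in \<open>b\<close> for the number of strings, and multiplying out
  one factor of the power (\<open>pnomial_Suc\<close>) gives the same recursion for the
  coefficients.
\<close>

text \<open>
  The empty string is included so that the decomposition into blocks starts from zero blocks.
\<close>

definition terminated_strings :: "nat \<Rightarrow> nat \<Rightarrow> nat \<Rightarrow> bool list set" where
  "terminated_strings p b w =
     {zs. (zs = [] \<or> \<not> last zs) \<and> fibonacci_string p zs \<and>
          count_list zs False = b \<and> count_list zs True = w}"

text \<open>
  An occurrence of a factor that straddles a letter contains that letter.
\<close>

lemma sublist_append_Cons_separator:
  assumes "c \<notin> set us"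
  shows "sublist us (xs @ c # ys) \<longleftrightarrow> sublist us xs \<or> sublist us ys"
proof
  have prefix_nil: "vs = []" if "prefix vs (c # ys)" "set vs \<subseteq> set us" for vs
    using that assms by (cases vs) auto
  assume "sublist us (xs @ c # ys)"
  then consider "sublist us xs" | "sublist us (c # ys)"
    | us1 us2 where "us = us1 @ us2" "suffix us1 xs" "prefix us2 (c # ys)"
    unfolding sublist_append by blast
  then show "sublist us xs \<or> sublist us ys"
  proof cases
    case 2
    then show ?thesis
      using prefix_nil[of us] by (auto simp: sublist_Cons_right)
  next
    case 3
    then have "us2 = []"
      using prefix_nil[of us2] by simp
    with 3 show ?thesis by auto
  qed simp
next
  assume "sublist us xs \<or> sublist us ys"
  then show "sublist us (xs @ c # ys)"
    by (auto simp: sublist_append sublist_Cons_right)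
qed

lemma sublist_replicate_replicate:
  "sublist (replicate p x) (replicate a x) \<longleftrightarrow> p \<le> a"
proof
  assume "sublist (replicate p x) (replicate a x)"
  from sublist_length_le[OF this] show "p \<le> a" by simp
next
  assume "p \<le> a"
  then show "sublist (replicate p x) (replicate a x)"
    by (metis le_add_diff_inverse replicate_add sublist_append_rightI)
qed

lemma fibonacci_string_append_zero:
  "fibonacci_string p (xs @ False # ys) \<longleftrightarrow> fibonacci_string p xs \<and> fibonacci_string p ys"
  by (simp add: fibonacci_string_def sublist_append_Cons_separator)

lemma fibonacci_string_block:
  "fibonacci_string p (replicate a True @ False # ys) \<longleftrightarrow> a < p \<and> fibonacci_string p ys"
  unfolding fibonacci_string_append_zero
  by (simp add: fibonacci_string_def sublist_replicate_replicate not_le)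

lemma fibonacci_string_Nil: "0 < p \<Longrightarrow> fibonacci_string p []"
  by (simp add: fibonacci_string_def)

lemma count_list_replicate_other: "count_list (replicate a x) y = (if x = y then a else 0)"
  by (induction a) auto

lemma count_list_bool: "count_list zs False + count_list zs True = length zs"
  by (induction zs) auto

lemma finite_terminated_strings: "finite (terminated_strings p b w)"
proof (rule finite_subset)
  show "terminated_strings p b w \<subseteq> {zs. set zs \<subseteq> UNIV \<and> length zs = b + w}"
    by (auto simp: terminated_strings_def count_list_bool)
qed (simp only: finite_lists_length_eq finite)

lemma terminated_strings_0:
  assumes "0 < p"
  shows "terminated_strings p 0 w = (if w = 0 then {[]} else {})"
proof -
  have "zs \<in> terminated_strings p 0 w \<longleftrightarrow> zs = [] \<and> w = 0" for zs
    using assms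
    by (cases zs rule: rev_cases) (auto simp: terminated_strings_def fibonacci_string_Nil)
  then show ?thesis by auto
qed

lemma inj_append_block: "inj (\<lambda>(a, ys). replicate a True @ False # ys)"
proof (rule injI, clarify)
  fix a a' ys ys'
  assume eq: "replicate a True @ False # ys = replicate a' True @ False # ys'"
  have run: "takeWhile id (replicate k True @ False # zs) = replicate k True" for k zs
    by (induction k) auto
  have "a = a'"
    using arg_cong[OF eq, of "\<lambda>zs. length (takeWhile id zs)"] unfolding run by simp
  with eq show "a = a' \<and> ys = ys'" by simp
qed

text \<open>
  The first block of a string ends at its first 0, and what follows is again empty or ends with 0.
  The index \<open>a\<close> ranges over the exponents that neither produce the forbidden run nor exceed the
  available weight; the latter restriction keeps the subtraction \<open>w - a\<close> faithful.
\<close>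

lemma terminated_strings_Suc:
  "terminated_strings p (Suc b) w =
     (\<lambda>(a, ys). replicate a True @ False # ys) `
       (SIGMA a:{a. a \<le> w \<and> a < p}. terminated_strings p b (w - a))"
    (is "_ = ?f ` ?S")
proof
  show "?f ` ?S \<subseteq> terminated_strings p (Suc b) w"
    by (auto simp: terminated_strings_def fibonacci_string_block count_list_replicate_other
        split: if_splits)
next
  show "terminated_strings p (Suc b) w \<subseteq> ?f ` ?S"
  proof
    fix zs assume zs: "zs \<in> terminated_strings p (Suc b) w"
    then have "count_list zs False \<noteq> 0"
      by (simp add: terminated_strings_def)
    then have "False \<in> set zs"
      by (simp add: count_list_0_iff)
    then obtain us ys where split: "zs = us @ False # ys" "False \<notin> set us"
      using split_list_first[of False zs] by blast
    from split(2) have "us = replicate (length us) True"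
      by (intro replicate_eqI) (auto intro: ccontr)
    then obtain a where "us = replicate a True" by (rule that)
    with split(1) have a: "zs = replicate a True @ False # ys" by simp
    with zs have "(a, ys) \<in> ?S"
      by (auto simp: terminated_strings_def fibonacci_string_block count_list_replicate_other
          split: if_splits)
    then show "zs \<in> ?f ` ?S"
      by (rule rev_image_eqI) (simp add: a)
  qed
qed

lemma pnomial_int:
  "pnomial p b (int a) = poly.coeff ((\<Sum>i<p. monom 1 i) ^ b) a"
  by (simp add: pnomial_def)

lemma pnomial_Suc:
  "pnomial p (Suc b) (int w) = (\<Sum>a | a \<le> w \<and> a < p. pnomial p b (int (w - a)))"
proof -
  have coeff: "poly.coeff (\<Sum>i<p. monom (1 :: nat) i) a = (if a < p then 1 else 0)" for a
    by (simp add: coeff_sum)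
  have "pnomial p (Suc b) (int w) = (\<Sum>a\<le>w. if a < p then pnomial p b (int (w - a)) else 0)"
    unfolding pnomial_int power_Suc coeff_mult coeff by (rule sum.cong) simp_all
  also have "\<dots> = (\<Sum>a | a \<in> {..w} \<and> a < p. pnomial p b (int (w - a)))"
    by (rule sum.inter_filter[symmetric]) simp
  finally show ?thesis by simp
qed

lemma card_terminated_strings:
  assumes "0 < p"
  shows "card (terminated_strings p b w) = pnomial p b (int w)"
proof (induction b arbitrary: w)
  case 0
  then show ?case
    using assms by (simp add: terminated_strings_0 pnomial_def)
next
  case (Suc b)
  have "card (terminated_strings p (Suc b) w) =
      card (SIGMA a:{a. a \<le> w \<and> a < p}. terminated_strings p b (w - a))"
    unfolding terminated_strings_Suc
    by (rule card_image) (rule inj_on_subset[OF inj_append_block subset_UNIV])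
  also have "\<dots> = (\<Sum>a | a \<le> w \<and> a < p. card (terminated_strings p b (w - a)))"
    by (rule card_SigmaI) (auto simp: finite_terminated_strings)
  also have "\<dots> = pnomial p (Suc b) (int w)"
    unfolding Suc.IH by (rule pnomial_Suc[symmetric])
  finally show ?case .
qed

text \<open>
  For \<open>w = n + 1\<close> both sides are empty: no string of length \<open>n\<close> has that weight, and a
  nonempty terminated string contains a 0.
\<close>

lemma append_zero_image_fibonacci_strings:
  assumes "0 < p" and "w \<le> n + 1"
  shows "(\<lambda>xs. xs @ [False]) ` {xs. length xs = n \<and> fibonacci_string p xs \<and> weight xs = w} =
     terminated_strings p (n + 1 - w) w"
    (is "?f ` ?A = ?T")
proof
  show "?f ` ?A \<subseteq> ?T"
  proof clarify
    fix xs assume "fibonacci_string p xs" and "n = length xs" and "w = weight xs"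
    with assms(1) count_list_bool[of xs]
    show "?f xs \<in> terminated_strings p (length xs + 1 - weight xs) (weight xs)"
      by (auto simp: terminated_strings_def weight_def fibonacci_string_append_zero
          fibonacci_string_Nil)
  qed
next
  show "?T \<subseteq> ?f ` ?A"
  proof
    fix zs assume zs: "zs \<in> ?T"
    with assms(2) have len: "length zs = n + 1"
      using count_list_bool[of zs] by (auto simp: terminated_strings_def)
    then obtain xs c where "zs = xs @ [c]"
      by (cases zs rule: rev_cases) auto
    with zs have xs: "zs = ?f xs"
      by (simp add: terminated_strings_def)
    with zs len have "xs \<in> ?A"
      by (auto simp: terminated_strings_def weight_def fibonacci_string_append_zero)
    with xs show "zs \<in> ?f ` ?A" by blast
  qed
qed

theorem theorem4p3:
  fixes p n w :: nat
  assumes "p \<ge> 2" and "w \<le> n + 1"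
  shows "card {xs \<in> verts (fibonacci_graph p n). weight xs = w} = pnomial p (n + 1 - w) (int w)"
proof -
  let ?A = "{xs. length xs = n \<and> fibonacci_string p xs \<and> weight xs = w}"
  have "card {xs \<in> verts (fibonacci_graph p n). weight xs = w} = card ?A"
    by (rule arg_cong[where f = card]) (auto simp: fibonacci_graph_def)
  also have "\<dots> = card ((\<lambda>xs. xs @ [False]) ` ?A)"
    by (rule card_image[symmetric]) (auto intro: inj_onI)
  also have "\<dots> = pnomial p (n + 1 - w) (int w)"
    using assms by (simp add: append_zero_image_fibonacci_strings card_terminated_strings)
  finally show ?thesis .
qed

end
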